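(* Suppose $G_{P_0}$ and $G_{Q_0}$ are two subgraphs of $G_{ph}$ induced by the disjoint vertex sets $V_P\subset[n]$ and $V_Q\subset[n]$, respectively. Suppose the following conditions hold: 1. $G_{P_0}$ is a connected graph. 2. Let $1,2,\dots,l\in V_P$ (after relabeling vertices, with $l\ge1$) be the nodes of $G_{P_0}$ that are adjacent in $G_{ph}$ to $V_Q$. Then the normalized adjacency matrix $A_{P_0}$ of $G_{P_0}$ has an eigenvalue $\lambda$ with $0<\lambda<1$, and there exists a corresponding eigenvector $v$ such that $v_1,\dots,v_l$ are all of the same sign, i.e., $v_iv_j>0$ for all $i,j\in[l]$. Let $G_P=G_P[k]$ and $G_Q=G_Q[k]$ denote the subgraphs of the influence graph $\tilde G[k]$ induced by $V_P$ and $V_Q$, respectively, and for $x_0\in\mathbb{R}^n$ let $k_M(x_0,V_P,V_Q)$ denote the time at which $G_P$ and $G_Q$ merge for the first time when the initial state is $x[0]=x_0$ (with $k_M=\infty$ if they never merge). Then there exists a set $\mathcal X_M\subset\mathbb{R}^n$ of initial states such that $k_M(x_0,V_P,V_Q)<\infty$ for all $x_0\in\mathcal X_M$ and $\sup_{x_0\in\mathcal X_M}k_M(x_0,V_P,V_Q)=\infty$.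
   Context: Social Hegselmann-Krause (HK) dynamics: there are $n$ agents, with $[n]=\{1,\dots,n\}$, and a fixed confidence bound $R>0$. The physical connectivity graph $G_{ph}=([n],E_{ph})$ is an undirected, time-invariant, connected graph containing all self-loops. The state at time $k=0,1,2,\dots$ is $x[k]\in\mathbb{R}^n$. The influence graph $\tilde G[k]$ has vertex set $[n]$ and has the edge $(i,j)$ iff $(i,j)\in E_{ph}$ and $|x_i[k]-x_j[k]|\le R$. The update rule is $x_i[k+1]=\frac{1}{|\mathcal N_i[k]|}\sum_{j\in\mathcal N_i[k]}x_j[k]$, where $\mathcal N_i[k]$ is the set of neighbors of $i$ in $\tilde G[k]$ (including $i$ itself). The normalized adjacency matrix of an undirected graph is $D^{-1}A_{adj}$, where $A_{adj}$ is the 0/1 adjacency matrix (with $1$ on the diagonal for a self-loop) and $D$ is the diagonal matrix of row sums of $A_{adj}$. Merging: if $\tilde G[k_0-1]$ is a disconnected graph ($k_0\ge1$) and $G_1,G_2$ are the subgraphs of $\tilde G$ induced by vertex sets $V_1,V_2$ that are disconnected from each other in $\tilde G[k_0-1]$, then $G_1$ and $G_2$ merge at time $k_0$ if some $i\in V_1$ and $j\in V_2$ become neighbors at time $k_0$, i.e., are adjacent in $\tilde G[k_0]$. *)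

theory Defs
  imports
    Complex_Main
    "HOL-Library.Extended_Nat"
    "Jordan_Normal_Form.Char_Poly"
    "Graph_Theory.Graph_Theory"
begin

text \<open>
  Undirected graphs (self-loops allowed) are symmetric digraphs without parallel arcs.  The agents
  are \<open>0, \<dots>, n - 1\<close>, in agreement with the indexing of vectors and matrices.
\<close>

text \<open>
  The rows and columns of the matrices of a graph \<open>G\<close> on natural numbers follow the increasing
  enumeration of \<open>verts G\<close>.
\<close>

definition vertex_at :: "(nat, 'b) pre_digraph \<Rightarrow> nat \<Rightarrow> nat" where
  "vertex_at G i = sorted_list_of_set (verts G) ! i"

definition adjacency_mat :: "(nat, 'b) pre_digraph \<Rightarrow> real mat" where
  "adjacency_mat G = mat (card (verts G)) (card (verts G))
     (\<lambda>(i, j). if vertex_at G i \<rightarrow>\<^bsub>G\<^esub> vertex_at G j then 1 else 0)"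

definition row_sum :: "real mat \<Rightarrow> nat \<Rightarrow> real" where
  "row_sum A i = (\<Sum>j<dim_col A. A $$ (i, j))"

text \<open>
  The left factor is the inverse of the diagonal matrix of row sums whenever no row sum is zero, in
  particular when every vertex has a self-loop.
\<close>

definition normalized_adjacency_mat :: "(nat, 'b) pre_digraph \<Rightarrow> real mat" where
  "normalized_adjacency_mat G =
     mat_diag (card (verts G)) (\<lambda>i. inverse (row_sum (adjacency_mat G) i)) * adjacency_mat G"

definition influence_graph :: "real \<Rightarrow> nat pair_pre_digraph \<Rightarrow> real vec \<Rightarrow> nat pair_pre_digraph" where
  "influence_graph R G x =
     \<lparr>pverts = pverts G, parcs = {(i, j). (i, j) \<in> parcs G \<and> \<bar>x $ i - x $ j\<bar> \<le> R}\<rparr>"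

definition neighbors :: "nat pair_pre_digraph \<Rightarrow> nat \<Rightarrow> nat set" where
  "neighbors G i = {j. i \<rightarrow>\<^bsub>G\<^esub> j}"

definition hk_step :: "real \<Rightarrow> nat pair_pre_digraph \<Rightarrow> real vec \<Rightarrow> real vec" where
  "hk_step R G x = vec (dim_vec x)
     (\<lambda>i. let N = neighbors (influence_graph R G x) i in (\<Sum>j\<in>N. x $ j) / real (card N))"

definition hk_state :: "real \<Rightarrow> nat pair_pre_digraph \<Rightarrow> real vec \<Rightarrow> nat \<Rightarrow> real vec" where
  "hk_state R G x0 k = (hk_step R G ^^ k) x0"

definition influence_graph_at ::
    "real \<Rightarrow> nat pair_pre_digraph \<Rightarrow> real vec \<Rightarrow> nat \<Rightarrow> nat pair_pre_digraph" where
  "influence_graph_at R G x0 k = influence_graph R G (hk_state R G x0 k)"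

text \<open>
  Two vertex sets are disconnected from each other if no path of the whole graph joins them, not
  merely if no edge does.
\<close>

definition disconnected_sets :: "nat pair_pre_digraph \<Rightarrow> nat set \<Rightarrow> nat set \<Rightarrow> bool" where
  "disconnected_sets G V1 V2 \<longleftrightarrow> (\<forall>i\<in>V1. \<forall>j\<in>V2. \<not> i \<rightarrow>\<^sup>*\<^bsub>G\<^esub> j)"

definition merge_at ::
    "real \<Rightarrow> nat pair_pre_digraph \<Rightarrow> real vec \<Rightarrow> nat set \<Rightarrow> nat set \<Rightarrow> nat \<Rightarrow> bool" where
  "merge_at R G x0 V1 V2 k \<longleftrightarrow>
     k \<ge> 1 \<and>
     \<not> Digraph_Component.connected (influence_graph_at R G x0 (k - 1)) \<and>
     disconnected_sets (influence_graph_at R G x0 (k - 1)) V1 V2 \<and>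
     (\<exists>i\<in>V1. \<exists>j\<in>V2. i \<rightarrow>\<^bsub>influence_graph_at R G x0 k\<^esub> j)"

text \<open>The infimum of the empty set is \<open>\<infinity>\<close>: the sets never merge.\<close>

definition merging_time ::
    "real \<Rightarrow> nat pair_pre_digraph \<Rightarrow> real vec \<Rightarrow> nat set \<Rightarrow> nat set \<Rightarrow> enat" where
  "merging_time R G x0 V1 V2 = Inf (enat ` {k. merge_at R G x0 V1 V2 k})"

text \<open>
  Positions, in the enumeration of the induced subgraph on \<open>V\<close>, of the vertices of \<open>V\<close> that are
  adjacent in \<open>G\<close> to \<open>W\<close>.
\<close>

definition boundary_positions :: "nat pair_pre_digraph \<Rightarrow> nat set \<Rightarrow> nat set \<Rightarrow> nat set" where
  "boundary_positions G V W = {i. i < card V \<and> (\<exists>q\<in>W. vertex_at (G \<restriction> V) i \<rightarrow>\<^bsub>G\<^esub> q)}"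

end

theory Submission
  imports Defs
begin

text \<open>
  Put every agent of \<open>VQ\<close> at position \<open>0\<close> and every agent outside \<open>VP \<union> VQ\<close> at \<open>4 * R\<close>, out of
  everybody's reach.  As long as no agent of \<open>VP\<close> sees one of \<open>VQ\<close>, these two groups stay where
  they are, and \<open>VP\<close> evolves as if it were alone.  If \<open>VP\<close> starts at a constant plus a multiple \<open>u\<close>
  of the eigenvector, small enough for its members to see all their neighbours in \<open>VP\<close>, then each
  step fixes the constant and multiplies the perturbation by the eigenvalue \<open>l\<close>.  The common sign of
  the boundary entries allows \<open>u\<close> to be positive on the boundary, so the boundary agents slide
  down towards the constant at the geometric rate \<open>l\<close> without reaching it.

  Let \<open>b\<close> be the boundary agent with the least \<open>u b\<close>.  With the constant \<open>R - l ^ T * u b\<close>, all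
  boundary agents are further than \<open>R\<close> from \<open>0\<close> before time \<open>T\<close>, because \<open>l ^ k * u b > l ^ T * u b\<close>
  for \<open>k < T\<close>, while at time \<open>T\<close> the agent \<open>b\<close> is at distance exactly \<open>R\<close>.  So the merging time
  is \<open>T\<close> (\<open>merging_time_config\<close>), and \<open>T\<close> is arbitrary.  The translation of the matrix
  eigenvector into an averaging identity on neighbourhoods is
  \<open>normalized_adjacency_eigenvector_sum\<close>.
\<close>

section \<open>Eigenvectors as functions on the vertices\<close>

lemma bij_betw_vertex_at:
  assumes "finite (verts H)"
  shows "bij_betw (vertex_at H) {..<card (verts H)} (verts H)"
  using bij_betw_nth[of "sorted_list_of_set (verts H)" "{..<card (verts H)}" "verts H"] assms
  by (simp add: vertex_at_def[abs_def])

text \<open>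
  The function \<open>u\<close> carries the entries of \<open>v\<close> over to the vertices themselves, which turns a row of
  the eigenvector equation, multiplied by its row sum, into a sum over a neighbourhood.  Clearing
  the denominator makes the identity hold also for a vertex without neighbours, where both sides
  vanish.
\<close>

lemma normalized_adjacency_eigenvector_sum:
  fixes H :: "(nat, 'b) pre_digraph"
  assumes "wf_digraph H" and fin: "finite (verts H)"
    and eig: "eigenvector (normalized_adjacency_mat H) v l"
    and u: "\<And>i. i < card (verts H) \<Longrightarrow> u (vertex_at H i) = v $ i"
    and x: "x \<in> verts H"
  shows "(\<Sum>y | x \<rightarrow>\<^bsub>H\<^esub> y. u y) = l * real (card {y. x \<rightarrow>\<^bsub>H\<^esub> y}) * u x"
proof -
  interpret wf_digraph H by fact
  define c where "c = card (verts H)"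
  define a where "a y = (if x \<rightarrow>\<^bsub>H\<^esub> y then 1 else 0 :: real)" for y
  have bij: "bij_betw (vertex_at H) {..<c} (verts H)"
    unfolding c_def by (rule bij_betw_vertex_at[OF fin])
  then obtain i where i: "i < c" "vertex_at H i = x"
    using x by (metis bij_betw_imp_surj_on imageE lessThan_iff)
  have sub: "{y. x \<rightarrow>\<^bsub>H\<^esub> y} \<subseteq> verts H"
    by (auto dest: adj_in_verts)
  have fin': "finite {y. x \<rightarrow>\<^bsub>H\<^esub> y}"
    using sub fin by (rule finite_subset)
  have reindex: "(\<Sum>j<c. a (vertex_at H j) * f (vertex_at H j)) = (\<Sum>y | x \<rightarrow>\<^bsub>H\<^esub> y. f y)"
    for f :: "nat \<Rightarrow> real"
  proof -
    have "(\<Sum>j<c. a (vertex_at H j) * f (vertex_at H j)) = (\<Sum>y\<in>verts H. a y * f y)"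
      using sum.reindex_bij_betw[OF bij, of "\<lambda>y. a y * f y"] .
    also have "\<dots> = (\<Sum>y | x \<rightarrow>\<^bsub>H\<^esub> y. f y)"
      using sub fin by (intro sum.mono_neutral_cong_right) (auto simp: a_def)
    finally show ?thesis .
  qed
  have entry: "adjacency_mat H $$ (i, j) = a (vertex_at H j)" if "j < c" for j
    using i that by (simp add: adjacency_mat_def c_def[symmetric] a_def)
  have row: "row_sum (adjacency_mat H) i = real (card {y. x \<rightarrow>\<^bsub>H\<^esub> y})"
  proof -
    have "row_sum (adjacency_mat H) i = (\<Sum>j<c. a (vertex_at H j) * 1)"
      unfolding row_sum_def using entry
      by (intro sum.cong) (auto simp: adjacency_mat_def c_def)
    also have "\<dots> = real (card {y. x \<rightarrow>\<^bsub>H\<^esub> y})"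
      using reindex[of "\<lambda>_. 1"] by simp
    finally show ?thesis .
  qed
  have A: "adjacency_mat H \<in> carrier_mat c c"
    by (simp add: adjacency_mat_def c_def)
  have N: "normalized_adjacency_mat H =
      mat_diag c (\<lambda>i. inverse (row_sum (adjacency_mat H) i)) * adjacency_mat H"
    by (simp add: normalized_adjacency_mat_def c_def)
  have v: "v \<in> carrier_vec c" "normalized_adjacency_mat H *\<^sub>v v = l \<cdot>\<^sub>v v"
    using eig A unfolding eigenvector_def N by (auto simp: mat_diag_def)
  have "l * u x = (normalized_adjacency_mat H *\<^sub>v v) $ i"
    using v i u[of i] by (simp add: c_def)
  also have "\<dots> = (\<Sum>j<c. inverse (row_sum (adjacency_mat H) i) * (a (vertex_at H j) * v $ j))"
    unfolding N mat_diag_mult_left[OF A] using i(1) v(1) A entry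
    by (simp add: scalar_prod_def lessThan_atLeast0 mult.assoc)
  also have "\<dots> = inverse (row_sum (adjacency_mat H) i) * (\<Sum>j<c. a (vertex_at H j) * u (vertex_at H j))"
    using u by (simp add: sum_distrib_left c_def)
  also have "\<dots> = inverse (real (card {y. x \<rightarrow>\<^bsub>H\<^esub> y})) * (\<Sum>y | x \<rightarrow>\<^bsub>H\<^esub> y. u y)"
    unfolding reindex row ..
  finally show ?thesis
    using fin' by (cases "card {y. x \<rightarrow>\<^bsub>H\<^esub> y} = 0") (auto simp: field_simps)
qed

section \<open>Closed sets and disconnectedness\<close>

lemma reachable_in_closed_set:
  assumes "x \<rightarrow>\<^sup>*\<^bsub>H\<^esub> y" and "x \<in> S"
    and closed: "\<And>a b. a \<rightarrow>\<^bsub>H\<^esub> b \<Longrightarrow> a \<in> S \<Longrightarrow> b \<in> S"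
  shows "y \<in> S"
proof -
  have "(x, y) \<in> (arcs_ends H)\<^sup>*"
    using assms(1) unfolding reachable_def by (rule rtrancl_on_rtranclI)
  then show ?thesis
    by induction (use \<open>x \<in> S\<close> closed in auto)
qed

text \<open>
  Connectedness of a digraph refers to its symmetric closure, hence the equivalence in the closure
  hypothesis: no arc may enter or leave \<open>S\<close>.
\<close>

lemma disconnected_by_closed_set:
  fixes H :: "nat pair_pre_digraph"
  assumes closed: "\<And>a b. (a, b) \<in> parcs H \<Longrightarrow> a \<in> S \<longleftrightarrow> b \<in> S"
    and "x \<in> S" "x \<in> pverts H" "y \<notin> S" "y \<in> pverts H"
  shows "\<not> Digraph_Component.connected H"
proof
  assume "Digraph_Component.connected H"
  then have "x \<rightarrow>\<^sup>*\<^bsub>with_proj (mk_symmetric H)\<^esub> y"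
    using assms by (auto simp: connected_def strongly_connected_def mk_symmetric_def)
  then have "y \<in> S"
    by (rule reachable_in_closed_set)
      (use \<open>x \<in> S\<close> closed in \<open>auto simp: mk_symmetric_def\<close>)
  with \<open>y \<notin> S\<close> show False by simp
qed

section \<open>A cluster that approaches another one at a geometric rate\<close>

lemma hk_step_index:
  assumes "i < dim_vec x"
  shows "hk_step R G x $ i = (\<Sum>j\<in>neighbors (influence_graph R G x) i. x $ j) /
    real (card (neighbors (influence_graph R G x) i))"
  using assms by (simp add: hk_step_def Let_def)

text \<open>
  Here \<open>u\<close> is the eigenvector as a function on \<open>P\<close>, scaled so that any two of its values differ by
  at most \<open>R\<close>, and \<open>b\<close> is the boundary agent, with a neighbour \<open>q\<close> in \<open>Q\<close>, that comes within
  reach of \<open>Q\<close> first.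
\<close>

locale decaying_cluster =
  fixes n :: nat and R :: real and G :: "nat pair_pre_digraph" and P Q :: "nat set"
    and l :: real and u :: "nat \<Rightarrow> real" and b q :: nat
  assumes R: "R > 0"
    and fin_sym: "pair_pseudo_graph G"
    and verts: "pverts G = {..<n}"
    and loops: "i < n \<Longrightarrow> (i, i) \<in> parcs G"
    and P: "P \<subseteq> {..<n}" and Q: "Q \<subseteq> {..<n}" and disj: "P \<inter> Q = {}"
    and l: "0 < l" "l < 1"
    and averaging: "i \<in> P \<Longrightarrow> (\<Sum>j | j \<in> P \<and> (i, j) \<in> parcs G. u j) =
          l * real (card {j \<in> P. (i, j) \<in> parcs G}) * u i"
    and bound: "i \<in> P \<Longrightarrow> \<bar>u i\<bar> \<le> R / 2"
    and b: "b \<in> P" and q: "q \<in> Q" and bq: "(b, q) \<in> parcs G" and ub: "u b > 0"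
    and minimal: "i \<in> P \<Longrightarrow> j \<in> Q \<Longrightarrow> (i, j) \<in> parcs G \<Longrightarrow> u b \<le> u i"
begin

text \<open>
  The state at time \<open>k \<le> T\<close> of the trajectory that merges at time \<open>T\<close>; \<open>hk_state_config\<close>
  justifies this reading.
\<close>

definition config :: "nat \<Rightarrow> nat \<Rightarrow> real vec" where
  "config T k = vec n (\<lambda>i. if i \<in> P then R - l ^ T * u b + l ^ k * u i
     else if i \<in> Q then 0 else 4 * R)"

lemma config_carrier: "config T k \<in> carrier_vec n"
  by (simp add: config_def)

definition same_part :: "nat \<Rightarrow> nat \<Rightarrow> bool" where
  "same_part i j \<longleftrightarrow> (i \<in> P \<longleftrightarrow> j \<in> P) \<and> (i \<in> Q \<longleftrightarrow> j \<in> Q)"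

lemma arc_vertices: "(i, j) \<in> parcs G \<Longrightarrow> i < n \<and> j < n"
proof -
  interpret pair_pseudo_graph G by (rule fin_sym)
  assume "(i, j) \<in> parcs G"
  then show ?thesis using in_arcsD1 in_arcsD2 verts by auto
qed

lemma arc_sym: "(i, j) \<in> parcs G \<Longrightarrow> (j, i) \<in> parcs G"
proof -
  interpret pair_pseudo_graph G by (rule fin_sym)
  show "(i, j) \<in> parcs G \<Longrightarrow> (j, i) \<in> parcs G"
    using pair_sym_arcs by (auto simp: symmetric_def elim: symE)
qed

lemma pow_times_u: "i \<in> P \<Longrightarrow> \<bar>l ^ k * u i\<bar> \<le> R / 2"
proof -
  assume i: "i \<in> P"
  have "\<bar>l ^ k * u i\<bar> \<le> 1 * \<bar>u i\<bar>"
    unfolding abs_mult using l by (intro mult_right_mono) (auto simp: power_le_one)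
  also have "\<dots> \<le> R / 2" using bound[OF i] by simp
  finally show ?thesis .
qed

text \<open>
  Before time \<open>T\<close> the confidence bound cuts precisely the arcs between different parts.  Between \<open>P\<close>
  and \<open>Q\<close> this is the choice of \<open>b\<close> as minimal on the boundary together with \<open>l < 1\<close>.  The
  agents outside \<open>P\<close> and \<open>Q\<close> are out of reach because all of \<open>P\<close> stays below \<open>3 * R / 2\<close>.
\<close>

lemma close_iff_same_part:
  assumes arc: "(i, j) \<in> parcs G" and "k < T"
  shows "\<bar>config T k $ i - config T k $ j\<bar> \<le> R \<longleftrightarrow> same_part i j"
proof -
  have far: "\<bar>config T k $ i - config T k $ j\<bar> > R"
    if ij: "(i, j) \<in> parcs G" and "i \<in> P" "j \<in> Q" for i j
  proof -
    have "l ^ T * u b < l ^ k * u b"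
      using ub l \<open>k < T\<close> by (simp add: power_strict_decreasing)
    also have "\<dots> \<le> l ^ k * u i"
      using minimal that l by (intro mult_left_mono) auto
    finally show ?thesis
      using that arc_vertices[OF ij] disj by (auto simp: config_def)
  qed
  have rest: "\<bar>config T k $ i - config T k $ j\<bar> > R"
    if ij: "(i, j) \<in> parcs G" and "j \<notin> P" "j \<notin> Q" "i \<in> P \<union> Q" for i j
    using that arc_vertices[OF ij] pow_times_u[of i k] pow_times_u[OF b, of T] R disj
    by (auto simp: config_def)
  have inside: "\<bar>config T k $ i - config T k $ j\<bar> \<le> R" if "same_part i j"
    using that arc_vertices[OF arc] pow_times_u[of i k] pow_times_u[of j k] R disj
    by (auto simp: config_def same_part_def)
  show ?thesis
  proof (cases "same_part i j")
    case False
    have swap: "\<bar>config T k $ j - config T k $ i\<bar> = \<bar>config T k $ i - config T k $ j\<bar>"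
      by (rule abs_minus_commute)
    have "\<bar>config T k $ i - config T k $ j\<bar> > R"
      using False disj far[OF arc] rest[OF arc] far[OF arc_sym[OF arc]] rest[OF arc_sym[OF arc]]
      unfolding swap same_part_def by blast
    with False show ?thesis by simp
  qed (use inside in simp)
qed

lemma influence_arcs:
  assumes "k < T"
  shows "parcs (influence_graph R G (config T k)) = {(i, j) \<in> parcs G. same_part i j}"
  using close_iff_same_part[OF _ assms] by (auto simp: influence_graph_def)

text \<open>
  All neighbours of an agent now lie in its own part.  Outside \<open>P\<close> they share its position, so
  averaging moves nothing; inside \<open>P\<close> averaging keeps the constant term and scales \<open>u\<close> by \<open>l\<close>.
\<close>

lemma hk_step_config:
  assumes "k < T"
  shows "hk_step R G (config T k) = config T (Suc k)"
proof (rule eq_vecI)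
  show "dim_vec (hk_step R G (config T k)) = dim_vec (config T (Suc k))"
    by (simp add: hk_step_def config_def)
next
  fix i assume "i < dim_vec (config T (Suc k))"
  then have i: "i < n" by (simp add: config_def)
  define N where "N = {j. (i, j) \<in> parcs G \<and> same_part i j}"
  have N: "neighbors (influence_graph R G (config T k)) i = N"
    by (auto simp: neighbors_def influence_arcs[OF assms] N_def)
  have "finite N"
    by (rule finite_subset[of _ "{..<n}"]) (auto simp: N_def dest: arc_vertices)
  moreover have "i \<in> N"
    using loops[OF i] by (simp add: N_def same_part_def)
  ultimately have card: "real (card N) > 0"
    by (auto simp: card_gt_0_iff)
  have step: "hk_step R G (config T k) $ i = (\<Sum>j\<in>N. config T k $ j) / real (card N)"
    unfolding N[symmetric] by (rule hk_step_index) (use i in \<open>simp add: config_def\<close>)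
  have "(\<Sum>j\<in>N. config T k $ j) = real (card N) * config T (Suc k) $ i"
  proof (cases "i \<in> P")
    case True
    then have NP: "N = {j \<in> P. (i, j) \<in> parcs G}"
      using disj by (auto simp: N_def same_part_def)
    have "(\<Sum>j\<in>N. config T k $ j) = (\<Sum>j\<in>N. (R - l ^ T * u b) + l ^ k * u j)"
      using P by (intro sum.cong) (auto simp: NP config_def)
    also have "\<dots> = real (card N) * (R - l ^ T * u b) + l ^ k * (\<Sum>j\<in>N. u j)"
      by (simp add: sum.distrib sum_distrib_left)
    also have "(\<Sum>j\<in>N. u j) = l * real (card N) * u i"
      using averaging[OF True] by (simp add: NP)
    finally show ?thesis
      using True i by (simp add: config_def algebra_simps)
  next
    case False
    have "(\<Sum>j\<in>N. config T k $ j) = (\<Sum>j\<in>N. config T (Suc k) $ i)"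
      using False i arc_vertices by (intro sum.cong) (auto simp: N_def same_part_def config_def)
    then show ?thesis by simp
  qed
  with card show "hk_step R G (config T k) $ i = config T (Suc k) $ i"
    by (simp add: step)
qed

lemma hk_state_config: "k \<le> T \<Longrightarrow> hk_state R G (config T 0) k = config T k"
  by (induction k) (simp_all add: hk_state_def hk_step_config)

text \<open>
  At time \<open>T\<close> the agent \<open>b\<close> is at \<open>R\<close> and \<open>q\<close> at \<open>0\<close>, which the closed confidence bound admits; one
  step earlier no arc leaves \<open>P\<close>.
\<close>

lemma merge_at_config:
  assumes "T \<ge> 1"
  shows "merge_at R G (config T 0) P Q T"
proof -
  let ?H = "influence_graph_at R G (config T 0) (T - 1)"
  have arcs: "parcs ?H = {(i, j) \<in> parcs G. same_part i j}"
    using assms influence_arcs[of "T - 1" T]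
    by (simp add: influence_graph_at_def hk_state_config)
  have "\<not> Digraph_Component.connected ?H"
    by (rule disconnected_by_closed_set[of _ P b q])
      (use arcs b q P Q disj verts in
        \<open>auto simp: same_part_def influence_graph_at_def influence_graph_def\<close>)
  moreover have "\<not> i \<rightarrow>\<^sup>*\<^bsub>?H\<^esub> j" if "i \<in> P" "j \<in> Q" for i j
  proof
    assume "i \<rightarrow>\<^sup>*\<^bsub>?H\<^esub> j"
    then have "j \<in> P"
      by (rule reachable_in_closed_set) (use that arcs in \<open>auto simp: same_part_def\<close>)
    then show False using that disj by blast
  qed
  moreover have "\<bar>config T T $ b - config T T $ q\<bar> \<le> R"
    using arc_vertices[OF bq] b q disj R by (auto simp: config_def)
  then have "b \<rightarrow>\<^bsub>influence_graph_at R G (config T 0) T\<^esub> q"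
    using bq by (simp add: influence_graph_at_def hk_state_config influence_graph_def)
  ultimately show ?thesis
    unfolding merge_at_def disconnected_sets_def using assms b q by blast
qed

lemma not_merge_at_config:
  assumes "k < T"
  shows "\<not> merge_at R G (config T 0) P Q k"
  using influence_arcs[OF assms] assms disj
  by (auto simp: merge_at_def influence_graph_at_def hk_state_config same_part_def)

lemma merging_time_config:
  assumes "T \<ge> 1"
  shows "merging_time R G (config T 0) P Q = enat T"
  unfolding merging_time_def
proof (rule antisym)
  show "Inf (enat ` {k. merge_at R G (config T 0) P Q k}) \<le> enat T"
    using merge_at_config[OF assms] by (intro Inf_lower) simp
  show "enat T \<le> Inf (enat ` {k. merge_at R G (config T 0) P Q k})"
    by (rule Inf_greatest) (use not_merge_at_config in \<open>auto simp: not_less[symmetric]\<close>)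
qed

lemma merging_time_unbounded:
  "\<exists>XM \<subseteq> carrier_vec n.
     (\<forall>x0\<in>XM. merging_time R G x0 P Q < \<infinity>) \<and> (SUP x0\<in>XM. merging_time R G x0 P Q) = \<infinity>"
proof -
  let ?XM = "(\<lambda>T. config T 0) ` {1..}"
  have "enat T \<le> (SUP x0\<in>?XM. merging_time R G x0 P Q)" for T
  proof -
    have "enat T \<le> merging_time R G (config (Suc T) 0) P Q"
      by (simp add: merging_time_config)
    also have "\<dots> \<le> (SUP x0\<in>?XM. merging_time R G x0 P Q)"
      by (intro SUP_upper) auto
    finally show ?thesis .
  qed
  then have "(SUP x0\<in>?XM. merging_time R G x0 P Q) = \<infinity>"
    by (metis Suc_n_not_le_n enat.exhaust enat_ord_simps(1))
  then show ?thesis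
    by (intro exI[of _ ?XM]) (auto simp: merging_time_config config_carrier)
qed

end

section \<open>Unbounded merging times\<close>

theorem proposition5:
  fixes n :: nat and R :: real and Gph :: "nat pair_pre_digraph" and VP VQ :: "nat set"
  assumes "R > 0"
    and "pair_pseudo_graph Gph"
    and "pverts Gph = {..<n}"
    and "\<And>i. i < n \<Longrightarrow> (i, i) \<in> parcs Gph"
    and "Digraph_Component.connected Gph"
    and "VP \<subseteq> {..<n}" and "VQ \<subseteq> {..<n}" and "VP \<inter> VQ = {}"
    and "Digraph_Component.connected (Gph \<restriction> VP)"
    and "boundary_positions Gph VP VQ \<noteq> {}"
    and "\<exists>l v. 0 < l \<and> l < 1 \<and> eigenvector (normalized_adjacency_mat (Gph \<restriction> VP)) v l \<and>
           (\<forall>i\<in>boundary_positions Gph VP VQ. \<forall>j\<in>boundary_positions Gph VP VQ. v $ i * v $ j > 0)"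
  shows "\<exists>XM \<subseteq> carrier_vec n.
           (\<forall>x0\<in>XM. merging_time R Gph x0 VP VQ < \<infinity>) \<and>
           (SUP x0\<in>XM. merging_time R Gph x0 VP VQ) = \<infinity>"
proof -
  interpret pair_pseudo_graph Gph by fact
  let ?H = "Gph \<restriction> VP" and ?B = "boundary_positions Gph VP VQ"
  obtain l v where l: "0 < l" "l < 1"
    and eig: "eigenvector (normalized_adjacency_mat ?H) v l"
    and sign: "\<And>i j. i \<in> ?B \<Longrightarrow> j \<in> ?B \<Longrightarrow> v $ i * v $ j > 0"
    using assms(11) by blast
  have finP: "finite VP" using \<open>VP \<subseteq> {..<n}\<close> by (rule finite_subset) simp
  have wfH: "wf_digraph ?H" by (rule wellformed_induce_subgraph)
  have bij: "bij_betw (vertex_at ?H) {..<card VP} VP"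
    using bij_betw_vertex_at[of ?H] finP by simp
  define w where "w x = v $ the_inv_into {..<card VP} (vertex_at ?H) x" for x
  have w: "w (vertex_at ?H i) = v $ i" if "i < card VP" for i
    using that bij by (simp add: w_def the_inv_into_f_f bij_betw_def)
  define B where "B = {i \<in> VP. \<exists>j\<in>VQ. (i, j) \<in> parcs Gph}"
  have B: "B = vertex_at ?H ` ?B"
    using bij by (force simp: B_def boundary_positions_def bij_betw_def)
  have finB: "finite B" using finP by (simp add: B_def)
  have signB: "w i * w j > 0" if ij: "i \<in> B" "j \<in> B" for i j
  proof -
    obtain i' j' where "i' \<in> ?B" "i = vertex_at ?H i'" "j' \<in> ?B" "j = vertex_at ?H j'"
      using ij unfolding B by blast
    then show ?thesis
      using sign[of i' j'] w[of i'] w[of j'] by (simp add: boundary_positions_def)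
  qed
  obtain b0 where b0: "b0 \<in> B" using assms(10) B by blast
  \<comment> \<open>The entry \<open>1\<close> only keeps the bound \<open>M\<close>, which becomes a divisor, positive.\<close>
  define M where "M = Max (insert 1 ((\<lambda>i. \<bar>w i\<bar>) ` VP))"
  have M: "M > 0" "\<And>i. i \<in> VP \<Longrightarrow> \<bar>w i\<bar> \<le> M"
    using finP by (auto simp: M_def Max_gr_iff)
  \<comment> \<open>The sign makes the boundary values positive, the size bounds the values on \<open>VP\<close> by \<open>R / 2\<close>.\<close>
  define c where "c = sgn (w b0) * (R / (2 * M))"
  have w0: "w b0 \<noteq> 0" using signB[OF b0 b0] by auto
  have cabs: "\<bar>c\<bar> = R / (2 * M)"
    using w0 M(1) \<open>R > 0\<close> by (simp add: c_def abs_mult abs_sgn_eq)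
  define u where "u i = c * w i" for i
  have upos: "u i > 0" if "i \<in> B" for i
  proof -
    have "sgn (w b0) * w i > 0"
      using signB[OF b0 that] by (auto simp: sgn_real_def zero_less_mult_iff split: if_splits)
    then have "(sgn (w b0) * w i) * (R / (2 * M)) > 0"
      by (rule mult_pos_pos) (use M(1) \<open>R > 0\<close> in simp)
    then show ?thesis by (simp add: u_def c_def mult_ac)
  qed
  have "\<exists>b\<in>B. \<forall>i\<in>B. u b \<le> u i"
    using finB b0 by (metis arg_min_if_finite(1) arg_min_least empty_iff)
  then obtain b where b: "b \<in> B" "\<And>i. i \<in> B \<Longrightarrow> u b \<le> u i" by blast
  then obtain q where q: "q \<in> VQ" "(b, q) \<in> parcs Gph" by (auto simp: B_def)
  have nbrs: "{j. i \<rightarrow>\<^bsub>?H\<^esub> j} = {j \<in> VP. (i, j) \<in> parcs Gph}" if "i \<in> VP" for i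
    using that by (auto simp: arcs_ends_conv image_iff)
  have averaging: "(\<Sum>j | j \<in> VP \<and> (i, j) \<in> parcs Gph. u j) =
      l * real (card {j \<in> VP. (i, j) \<in> parcs Gph}) * u i" if "i \<in> VP" for i
  proof -
    have "(\<Sum>j | i \<rightarrow>\<^bsub>?H\<^esub> j. w j) = l * real (card {j. i \<rightarrow>\<^bsub>?H\<^esub> j}) * w i"
      by (rule normalized_adjacency_eigenvector_sum[OF wfH _ eig])
        (use finP w that in auto)
    then show ?thesis
      by (simp add: nbrs[OF that] u_def sum_distrib_left[symmetric])
  qed
  have bound: "\<bar>u i\<bar> \<le> R / 2" if "i \<in> VP" for i
  proof -
    have "\<bar>u i\<bar> \<le> R / (2 * M) * M"
      unfolding u_def abs_mult cabs using M(1) M(2)[OF that] \<open>R > 0\<close>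
      by (intro mult_left_mono) auto
    then show ?thesis using M(1) by simp
  qed
  have minimal: "u b \<le> u i" if "i \<in> VP" "j \<in> VQ" "(i, j) \<in> parcs Gph" for i j
    by (rule b(2)) (use that in \<open>auto simp: B_def\<close>)
  have "b \<in> VP" using b(1) by (simp add: B_def)
  have "decaying_cluster n R Gph VP VQ l u b q"
    by (rule decaying_cluster.intro)
      (fact assms l averaging bound minimal \<open>b \<in> VP\<close> q upos[OF b(1)])+
  then show ?thesis by (rule decaying_cluster.merging_time_unbounded)
qed

end
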